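(* Let $X\neq\{0\}$ be a real Hilbert space and let $e\in X$ satisfy $\|e\|\le 1$. Then the following hold: (i) (duality) $-R_e=R_{-e}$, $\mathrm{Id}-T_e=T_{-e}$, and $(A_e)^{-1}=A_{-e}$. (ii) (cone) For all $x\in X$ and all real $\lambda>0$, $A_e(\lambda x)=\lambda A_e x$. Consequently, $\operatorname{gra}A_e$ is a (nonconvex) cone. (iii) If $\|e\|=1$, then $\langle x,u\rangle=0$ for all $(x,u)\in\operatorname{gra}A_e$. (iv) If $\|e\|=1$, then $\operatorname{zer}A_e=(A_e)^{-1}(0)=\mathbb{R}_+\cdot e$.
   Context: For every $e$ in a real Hilbert space $X\ne\{0\}$ (with inner product $\langle\cdot,\cdot\rangle$ and induced norm $\|\cdot\|$) with $\|e\|\le 1$, define $R_e\colon X\to X\colon x\mapsto \|x\|\,e$ and $T_e\colon X\to X\colon x\mapsto \tfrac12 x+\tfrac12 R_e x=\tfrac12x+\tfrac12\|x\|e$. The map $R_e$ is nonexpansive, so $T_e$ is firmly nonexpansive and is the resolvent $J_{A_e}=(\mathrm{Id}+A_e)^{-1}$ of the maximally monotone set-valued operator $A_e=T_e^{-1}-\mathrm{Id}$, where $\mathrm{Id}$ is the identity on $X$ and inverses are in the sense of set-valued operators; equivalently, the graph of $A_e$ is $\operatorname{gra}A_e=\{(T_ey,\,y-T_ey) : y\in X\}\subseteq X\times X$. For a set-valued operator $A$ on $X$, $\operatorname{zer}A=\{x\in X: 0\in Ax\}$. A cone is a set closed under multiplication by strictly positive scalars. $\mathbb{R}_+\cdot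 e=\{te : t\ge 0\}$.
   Formalization: Nonconvexity of gra A_e in (ii) is asserted only for e ≠ 0, because for e = 0 one has A_0 = Id, whose graph is a convex subspace; the cone property is stated for all e. *)

theory Defs
  imports "HOL-Analysis.Analysis"
begin

text \<open>A set-valued operator on X is a function mapping points of X to subsets of X.
  The difference of two such operators is the pointwise Minkowski difference;
  the minus of the type \<open>'a set\<close> would be set difference.\<close>

definition gra :: "('a \<Rightarrow> 'a set) \<Rightarrow> ('a \<times> 'a) set" where
  "gra A = {(x, u). u \<in> A x}"

definition sv_of_fun :: "('a \<Rightarrow> 'a) \<Rightarrow> 'a \<Rightarrow> 'a set" where
  "sv_of_fun F x = {F x}"

definition sv_inverse :: "('a \<Rightarrow> 'a set) \<Rightarrow> 'a \<Rightarrow> 'a set" where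
  "sv_inverse A u = {x. u \<in> A x}"

definition sv_diff :: "('a::minus \<Rightarrow> 'a set) \<Rightarrow> ('a \<Rightarrow> 'a set) \<Rightarrow> 'a \<Rightarrow> 'a set" where
  "sv_diff A B x = {a - b | a b. a \<in> A x \<and> b \<in> B x}"

definition zer :: "('a::zero \<Rightarrow> 'a set) \<Rightarrow> 'a set" where
  "zer A = {x. 0 \<in> A x}"

text \<open>Unlike the library's \<^const>\<open>cone\<close>, only strictly positive scalars are required, so a
  cone need not contain the origin.\<close>

definition pos_cone :: "'a::real_vector set \<Rightarrow> bool" where
  "pos_cone C \<longleftrightarrow> (\<forall>x\<in>C. \<forall>c>0. c *\<^sub>R x \<in> C)"

definition R_map :: "'a::real_normed_vector \<Rightarrow> 'a \<Rightarrow> 'a" where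
  "R_map e x = norm x *\<^sub>R e"

definition T_map :: "'a::real_normed_vector \<Rightarrow> 'a \<Rightarrow> 'a" where
  "T_map e x = (1/2) *\<^sub>R x + (1/2) *\<^sub>R R_map e x"

definition A_op :: "'a::real_normed_vector \<Rightarrow> 'a \<Rightarrow> 'a set" where
  "A_op e = sv_diff (sv_inverse (sv_of_fun (T_map e))) (sv_of_fun id)"

end

theory Submission
  imports Defs
begin

text \<open>Since \<open>A\<^sub>e\<close> has resolvent \<open>T\<^sub>e\<close>, membership \<open>u \<in> A\<^sub>e x\<close> says that the point \<open>y = x + u\<close>
  satisfies \<open>T\<^sub>e y = x\<close>. As \<open>T\<^sub>e\<close> is the average of the identity and \<open>R\<^sub>e\<close>, this unfolds to the
  implicit equation \<open>x - u = \<parallel>x + u\<parallel> e\<close> (\<open>A_op_iff\<close>), from which every assertion can be read off.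
  Exchanging \<open>x\<close> and \<open>u\<close> changes the sign of the left-hand side, which amounts to replacing \<open>e\<close>
  by \<open>-e\<close>: this is the duality. Both sides are positively homogeneous in \<open>(x, u)\<close>, so the graph
  is a cone. If \<open>\<parallel>e\<parallel> = 1\<close>, taking norms gives \<open>\<parallel>x - u\<parallel> = \<parallel>x + u\<parallel>\<close>, i.e. \<open>x\<close> and \<open>u\<close> are
  orthogonal; putting \<open>u = 0\<close> leaves \<open>x = \<parallel>x\<parallel> e\<close>, whose solutions form the ray through \<open>e\<close>.

  If \<open>e \<noteq> 0\<close>, convexity fails because \<open>\<parallel>x + u\<parallel>\<close> is not additive: averaging the graph points that belong to
  \<open>y = e\<close> and \<open>y = -e\<close> cancels \<open>x + u\<close>, but not \<open>x - u\<close>.\<close>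

lemma A_op_iff: "u \<in> A_op e x \<longleftrightarrow> x - u = norm (x + u) *\<^sub>R e"
proof -
  have "u \<in> A_op e x \<longleftrightarrow> T_map e (x + u) = x"
    unfolding A_op_def sv_diff_def sv_inverse_def sv_of_fun_def
    by (force simp: algebra_simps)
  also have "\<dots> \<longleftrightarrow> (2::real) *\<^sub>R T_map e (x + u) = 2 *\<^sub>R x"
    by simp
  also have "\<dots> \<longleftrightarrow> x - u = norm (x + u) *\<^sub>R e"
    unfolding T_map_def R_map_def
    by (auto simp: scaleR_2 algebra_simps)
  finally show ?thesis .
qed

lemma uminus_R_map: "- R_map e = R_map (- e)"
  by (auto simp: R_map_def)

lemma id_minus_T_map:
  fixes e :: "'a::real_normed_vector"
  shows "id - T_map e = T_map (- e)"
proof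
  fix x :: 'a
  have "x = (1/2::real) *\<^sub>R x + (1/2::real) *\<^sub>R x"
    by (metis scaleR_half_double scaleR_right_distrib)
  then show "(id - T_map e) x = T_map (- e) x"
    by (simp add: T_map_def R_map_def algebra_simps)
qed

lemma sv_inverse_A_op: "sv_inverse (A_op e) = A_op (- e)"
proof (intro ext set_eqI)
  fix u x
  have "x - u = norm (x + u) *\<^sub>R e \<longleftrightarrow> u - x = norm (u + x) *\<^sub>R (- e)"
    by (metis add.commute minus_diff_eq scaleR_minus_right minus_minus)
  then show "x \<in> sv_inverse (A_op e) u \<longleftrightarrow> x \<in> A_op (- e) u"
    by (simp add: sv_inverse_def A_op_iff)
qed

lemma A_op_scaleR_iff:
  assumes "l > 0"
  shows "l *\<^sub>R u \<in> A_op e (l *\<^sub>R x) \<longleftrightarrow> u \<in> A_op e x"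
proof -
  have "norm (l *\<^sub>R x + l *\<^sub>R u) = l * norm (x + u)"
    using assms by (simp flip: scaleR_right_distrib)
  then have "l *\<^sub>R u \<in> A_op e (l *\<^sub>R x) \<longleftrightarrow> l *\<^sub>R (x - u) = l *\<^sub>R (norm (x + u) *\<^sub>R e)"
    by (simp add: A_op_iff scaleR_diff_right)
  also have "\<dots> \<longleftrightarrow> u \<in> A_op e x"
    using assms by (simp only: A_op_iff scaleR_cancel_left) simp
  finally show ?thesis .
qed

lemma A_op_scaleR:
  assumes "l > 0"
  shows "A_op e (l *\<^sub>R x) = (\<lambda>u. l *\<^sub>R u) ` A_op e x"
proof (intro equalityI subsetI)
  fix v assume v: "v \<in> A_op e (l *\<^sub>R x)"
  have "v = l *\<^sub>R (inverse l *\<^sub>R v)"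
    using assms by simp
  then show "v \<in> (\<lambda>u. l *\<^sub>R u) ` A_op e x"
    using v A_op_scaleR_iff[OF assms] by (metis imageI)
qed (use A_op_scaleR_iff[OF assms] in auto)

lemma pos_cone_gra_A_op: "pos_cone (gra (A_op e))"
  by (auto simp: pos_cone_def gra_def A_op_scaleR_iff)

text \<open>Up to the factor \<open>1/2\<close>, the two points below are \<open>(T\<^sub>e y, y - T\<^sub>e y)\<close> for
  \<open>y = e\<close> and \<open>y = -e\<close>; their midpoint \<open>(\<parallel>e\<parallel> e, -\<parallel>e\<parallel> e)\<close> has coordinate sum zero.\<close>

lemma not_convex_gra_A_op:
  assumes "e \<noteq> 0"
  shows "\<not> convex (gra (A_op e))"
proof
  assume convex: "convex (gra (A_op e))"
  define d where "d = norm e *\<^sub>R e"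
  have sums: "e + d + (e - d) = (2::real) *\<^sub>R e" "- e + d + (- e - d) = (-2::real) *\<^sub>R e"
    and differences: "e + d - (e - d) = (2::real) *\<^sub>R d" "- e + d - (- e - d) = (2::real) *\<^sub>R d"
    by (simp_all add: scaleR_2)
  have "(e + d, e - d) \<in> gra (A_op e)" "(- e + d, - e - d) \<in> gra (A_op e)"
    unfolding gra_def by (simp_all only: A_op_iff sums differences mem_Collect_eq case_prod_conv)
      (simp_all add: d_def)
  then have "(1/2::real) *\<^sub>R (e + d, e - d) + (1/2::real) *\<^sub>R (- e + d, - e - d) \<in> gra (A_op e)"
    by (intro convexD[OF convex]) auto
  moreover have "(1/2::real) *\<^sub>R (e + d, e - d) + (1/2::real) *\<^sub>R (- e + d, - e - d) = (d, - d)"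
    by (simp add: algebra_simps flip: scaleR_left_distrib)
  ultimately have "d + d = 0"
    by (simp add: gra_def A_op_iff)
  then have "d = 0"
    by (simp flip: scaleR_2)
  then show False
    using assms by (simp add: d_def)
qed

lemma A_op_orthogonal:
  fixes e :: "'a::real_inner"
  assumes "norm e = 1" and "u \<in> A_op e x"
  shows "x \<bullet> u = 0"
proof -
  have "norm (x - u) = norm (x + u)"
    using assms by (simp add: A_op_iff)
  then have "(x - u) \<bullet> (x - u) = (x + u) \<bullet> (x + u)"
    by (simp add: norm_eq)
  then show ?thesis
    by (simp add: inner_simps inner_commute)
qed

lemma zer_A_op:
  assumes "norm e = 1"
  shows "zer (A_op e) = {t *\<^sub>R e | t. t \<ge> 0}"
proof -
  have "x = norm x *\<^sub>R e \<longleftrightarrow> (\<exists>t\<ge>0. x = t *\<^sub>R e)" for x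
    using assms by (metis norm_ge_zero norm_scaleR abs_of_nonneg mult.right_neutral)
  then show ?thesis
    by (auto simp: zer_def A_op_iff)
qed

lemma zer_eq_sv_inverse_zero: "zer A = sv_inverse A 0"
  by (simp add: zer_def sv_inverse_def)

theorem lemma3p1:
  fixes e :: "'a::{real_inner, complete_space}"
  assumes "(UNIV :: 'a set) \<noteq> {0}"
    and "norm e \<le> 1"
  shows "(- R_map e = R_map (- e) \<and> id - T_map e = T_map (- e) \<and> sv_inverse (A_op e) = A_op (- e))
    \<and> ((\<forall>x. \<forall>l::real. l > 0 \<longrightarrow> A_op e (l *\<^sub>R x) = (\<lambda>u. l *\<^sub>R u) ` A_op e x)
        \<and> pos_cone (gra (A_op e)) \<and> (e \<noteq> 0 \<longrightarrow> \<not> convex (gra (A_op e))))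
    \<and> (norm e = 1 \<longrightarrow> (\<forall>(x, u) \<in> gra (A_op e). x \<bullet> u = 0))
    \<and> (norm e = 1 \<longrightarrow> zer (A_op e) = sv_inverse (A_op e) 0
        \<and> sv_inverse (A_op e) 0 = {t *\<^sub>R e | t. t \<ge> 0})"
proof (intro conjI impI)
  show "- R_map e = R_map (- e)"
    by (rule uminus_R_map)
  show "id - T_map e = T_map (- e)"
    by (rule id_minus_T_map)
  show "sv_inverse (A_op e) = A_op (- e)"
    by (rule sv_inverse_A_op)
  show "\<forall>x. \<forall>l::real. l > 0 \<longrightarrow> A_op e (l *\<^sub>R x) = (\<lambda>u. l *\<^sub>R u) ` A_op e x"
    using A_op_scaleR by blast
  show "pos_cone (gra (A_op e))"
    by (rule pos_cone_gra_A_op)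
  show "\<not> convex (gra (A_op e))" if "e \<noteq> 0"
    using that by (rule not_convex_gra_A_op)
  show "\<forall>(x, u) \<in> gra (A_op e). x \<bullet> u = 0" if "norm e = 1"
    using A_op_orthogonal[OF that] by (auto simp: gra_def)
  show "zer (A_op e) = sv_inverse (A_op e) 0"
    by (rule zer_eq_sv_inverse_zero)
  show "sv_inverse (A_op e) 0 = {t *\<^sub>R e | t. t \<ge> 0}" if "norm e = 1"
    using zer_A_op[OF that] by (simp add: zer_eq_sv_inverse_zero)
qed

end
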